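(* Let $\mathcal{A}\subset\mathbb{R}^d$ be a finite set whose convex hull $\Delta$ has dimension $d$, and let $\beta=\{\beta_{\mathbf a}\mid \mathbf a\in\mathcal{A}\}$ be a proper patch on $\Delta$. Then $\beta$ has a unique reparametrization that has linear precision; that is, there is exactly one homeomorphism $\psi\colon\Delta\to\Delta$ such that the patch $\{\beta_{\mathbf a}\circ\psi\mid\mathbf a\in\mathcal{A}\}$ has linear precision.
   Context: A (parametric) patch indexed by a finite set $\mathcal{A}\subset\mathbb{R}^d$ with full-dimensional convex hull $\Delta$ is a collection $\{\beta_{\mathbf a}\mid\mathbf a\in\mathcal{A}\}$ of non-negative real-valued functions (blending functions) on $\Delta$ that do not vanish simultaneously at any point of $\Delta$. Blending functions are taken to be smooth ($C^\infty$), but reparametrized blending functions are only required to be continuous. Blending functions are replaced by their normalizations $\beta_{\mathbf a}/\sum_{\mathbf b\in\mathcal{A}}\beta_{\mathbf b}$, so that $\sum_{\mathbf a\in\mathcal{A}}\beta_{\mathbf a}(x)=1$ for $x\in\Delta$. The patch has linear precision if for every affine function $\Lambda$ on $\mathbb{R}^d$, $\Lambda(x)=\sum_{\mathbf a\in\mathcal{A}}\beta_{\mathbf a}(x)\Lambda(\mathbf a)$ for all $x\in\Delta$. The tautological map of the patch is $\tau\colon\Delta\to\Delta$, $\tau(x)=\sum_{\mathbf a\in\mathcal{A}}\beta_{\mathbf a}(x)\,\mathbf a$. The patch is proper if $\tau$ is a homeomorphism of $\Delta$. The reparametrization of the patch by a homeomorphism $\psi\colon\Delta\to\Delta$ is the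 patch with blending functions $\beta_{\mathbf a}\circ\psi$, $\mathbf a\in\mathcal{A}$. *)

theory Defs
  imports "HOL-Analysis.Analysis"
begin

text \<open>\<open>C_k_on\<close> is meant for open sets \<open>U\<close>: all iterated directional
  derivatives up to order \<open>k\<close> exist and are continuous on \<open>U\<close>.\<close>

primrec C_k_on :: "nat \<Rightarrow> ('a::euclidean_space \<Rightarrow> real) \<Rightarrow> 'a set \<Rightarrow> bool" where
  "C_k_on 0 f U \<longleftrightarrow> continuous_on U f"
| "C_k_on (Suc k) f U \<longleftrightarrow>
     f differentiable_on U \<and> (\<forall>v. C_k_on k (\<lambda>x. frechet_derivative f (at x) v) U)"

text \<open>Smoothness on a set that need not be open: existence of a smooth extension to an open
  neighbourhood.\<close>

definition C_infinity_on :: "('a::euclidean_space \<Rightarrow> real) \<Rightarrow> 'a set \<Rightarrow> bool" where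
  "C_infinity_on f S \<longleftrightarrow>
     (\<exists>U g. open U \<and> S \<subseteq> U \<and> (\<forall>x\<in>S. g x = f x) \<and> (\<forall>k. C_k_on k g U))"

text \<open>Patches are indexed by a finite set \<open>A\<close> and live on the domain \<open>convex hull A\<close>; the values
  \<open>\<beta> a x\<close> for \<open>a \<notin> A\<close> or \<open>x \<notin> convex hull A\<close> are irrelevant. A \<open>patch\<close> only has
  continuous blending functions, so that reparametrizations of patches are patches.\<close>

definition patch :: "(real^'d) set \<Rightarrow> (real^'d \<Rightarrow> real^'d \<Rightarrow> real) \<Rightarrow> bool" where
  "patch A \<beta> \<longleftrightarrow>
     (\<forall>a\<in>A. continuous_on (convex hull A) (\<beta> a)) \<and>
     (\<forall>a\<in>A. \<forall>x\<in>convex hull A. 0 \<le> \<beta> a x) \<and>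
     (\<forall>x\<in>convex hull A. \<exists>a\<in>A. \<beta> a x \<noteq> 0)"

definition smooth_patch :: "(real^'d) set \<Rightarrow> (real^'d \<Rightarrow> real^'d \<Rightarrow> real) \<Rightarrow> bool" where
  "smooth_patch A \<beta> \<longleftrightarrow> patch A \<beta> \<and> (\<forall>a\<in>A. C_infinity_on (\<beta> a) (convex hull A))"

definition normalization ::
    "(real^'d) set \<Rightarrow> (real^'d \<Rightarrow> real^'d \<Rightarrow> real) \<Rightarrow> real^'d \<Rightarrow> real^'d \<Rightarrow> real" where
  "normalization A \<beta> = (\<lambda>a x. \<beta> a x / (\<Sum>b\<in>A. \<beta> b x))"

definition affine_function :: "(real^'d \<Rightarrow> real) \<Rightarrow> bool" where
  "affine_function \<Lambda> \<longleftrightarrow> (\<exists>f c. linear f \<and> \<Lambda> = (\<lambda>x. f x + c))"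

text \<open>The next notions are applied to normalized blending functions.\<close>

definition linear_precision :: "(real^'d) set \<Rightarrow> (real^'d \<Rightarrow> real^'d \<Rightarrow> real) \<Rightarrow> bool" where
  "linear_precision A \<beta> \<longleftrightarrow>
     (\<forall>\<Lambda>. affine_function \<Lambda> \<longrightarrow>
       (\<forall>x\<in>convex hull A. \<Lambda> x = (\<Sum>a\<in>A. \<beta> a x * \<Lambda> a)))"

definition tautological_map ::
    "(real^'d) set \<Rightarrow> (real^'d \<Rightarrow> real^'d \<Rightarrow> real) \<Rightarrow> real^'d \<Rightarrow> real^'d" where
  "tautological_map A \<beta> x = (\<Sum>a\<in>A. \<beta> a x *\<^sub>R a)"

definition self_homeomorphism :: "(real^'d) set \<Rightarrow> (real^'d \<Rightarrow> real^'d) \<Rightarrow> bool" where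
  "self_homeomorphism S f \<longleftrightarrow> (\<exists>g. homeomorphism S S f g)"

definition proper :: "(real^'d) set \<Rightarrow> (real^'d \<Rightarrow> real^'d \<Rightarrow> real) \<Rightarrow> bool" where
  "proper A \<beta> \<longleftrightarrow> self_homeomorphism (convex hull A) (tautological_map A \<beta>)"

definition reparametrization ::
    "(real^'d \<Rightarrow> real^'d \<Rightarrow> real) \<Rightarrow> (real^'d \<Rightarrow> real^'d) \<Rightarrow> real^'d \<Rightarrow> real^'d \<Rightarrow> real" where
  "reparametrization \<beta> \<psi> = (\<lambda>a. \<beta> a \<circ> \<psi>)"

lemma patch_sum_pos:
  assumes "finite A" "patch A \<beta>" "x \<in> convex hull A"
  shows "(\<Sum>b\<in>A. \<beta> b x) > 0"
proof -
  obtain a where "a \<in> A" "\<beta> a x \<noteq> 0"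
    using assms unfolding patch_def by blast
  moreover have "\<forall>b\<in>A. 0 \<le> \<beta> b x"
    using assms unfolding patch_def by blast
  ultimately show ?thesis
    using assms(1) by (intro sum_pos2[of A a]) (auto simp: less_le)
qed

lemma patch_normalization:
  assumes "finite A" "patch A \<beta>"
  shows "patch A (normalization A \<beta>)"
proof -
  have nz: "(\<Sum>b\<in>A. \<beta> b x) > 0" if "x \<in> convex hull A" for x
    using patch_sum_pos[OF assms that] .
  have "continuous_on (convex hull A) (\<lambda>x. \<beta> a x / (\<Sum>b\<in>A. \<beta> b x))" if "a \<in> A" for a
    using assms that nz unfolding patch_def
    by (intro continuous_on_divide continuous_on_sum) (force+)
  moreover have "0 \<le> \<beta> a x / (\<Sum>b\<in>A. \<beta> b x)" if "a \<in> A" "x \<in> convex hull A" for a x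
    using assms that nz[OF that(2)] unfolding patch_def by (simp add: less_imp_le)
  moreover have "\<exists>a\<in>A. \<beta> a x / (\<Sum>b\<in>A. \<beta> b x) \<noteq> 0" if "x \<in> convex hull A" for x
    using assms that nz[OF that] unfolding patch_def by (metis divide_eq_0_iff less_irrefl)
  ultimately show ?thesis
    unfolding patch_def normalization_def by blast
qed

lemma sum_normalization:
  assumes "finite A" "patch A \<beta>" "x \<in> convex hull A"
  shows "(\<Sum>a\<in>A. normalization A \<beta> a x) = 1"
  using patch_sum_pos[OF assms]
  by (simp add: normalization_def flip: sum_divide_distrib)

lemma patch_reparametrization:
  assumes "patch A \<beta>" "self_homeomorphism (convex hull A) \<psi>"
  shows "patch A (reparametrization \<beta> \<psi>)"
proof -
  have c: "continuous_on (convex hull A) \<psi>" and im: "\<psi> ` (convex hull A) = convex hull A"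
    using assms(2) unfolding self_homeomorphism_def homeomorphism_def by blast+
  have "continuous_on (convex hull A) (\<beta> a \<circ> \<psi>)" if "a \<in> A" for a
    using assms(1) that c im unfolding patch_def by (metis continuous_on_compose)
  moreover have "\<psi> x \<in> convex hull A" if "x \<in> convex hull A" for x
    using im that by blast
  ultimately show ?thesis
    using assms(1) unfolding patch_def reparametrization_def by auto
qed

end

theory Submission
  imports Defs
begin

text \<open>Testing linear precision on the coordinate functions shows that it says exactly
  that the tautological map is the identity. Since reparametrizing by \<open>\<psi>\<close>
  replaces the tautological map \<open>\<tau>\<close> by \<open>\<tau> \<circ> \<psi>\<close>, the only reparametrization with
  linear precision is the one by the inverse of \<open>\<tau>\<close>.\<close>

lemma linear_precision_iff_tautological_map:
  assumes "\<And>x. x \<in> convex hull A \<Longrightarrow> (\<Sum>a\<in>A. \<beta> a x) = 1"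
  shows "linear_precision A \<beta> \<longleftrightarrow> (\<forall>x\<in>convex hull A. tautological_map A \<beta> x = x)"
proof
  assume lp: "linear_precision A \<beta>"
  show "\<forall>x\<in>convex hull A. tautological_map A \<beta> x = x"
  proof
    fix x assume x: "x \<in> convex hull A"
    have "tautological_map A \<beta> x $ i = x $ i" for i
    proof -
      have "linear (\<lambda>y::real^'a. y $ i)"
        by (simp add: linear_iff)
      then have "affine_function (\<lambda>y::real^'a. y $ i)"
        unfolding affine_function_def by (intro exI[of _ "\<lambda>y. y $ i"] exI[of _ 0]) simp
      then show ?thesis
        using lp x by (simp add: linear_precision_def tautological_map_def)
    qed
    then show "tautological_map A \<beta> x = x"
      by (simp add: vec_eq_iff)
  qed
next
  assume taut: "\<forall>x\<in>convex hull A. tautological_map A \<beta> x = x"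
  show "linear_precision A \<beta>"
    unfolding linear_precision_def affine_function_def
  proof (intro allI impI ballI, elim exE conjE)
    fix \<Lambda> f :: "real^'a \<Rightarrow> real" and c x
    assume x: "x \<in> convex hull A" and f: "linear f" and \<Lambda>: "\<Lambda> = (\<lambda>x. f x + c)"
    \<comment> \<open>The linear part commutes with the weighted sum, whereas the constant
      \<open>c\<close> is multiplied by the total weight; that weight is 1, so \<open>c\<close>
      survives unchanged.\<close>
    have "(\<Sum>a\<in>A. \<beta> a x * \<Lambda> a) = f (tautological_map A \<beta> x) + (\<Sum>a\<in>A. \<beta> a x) * c"
      by (simp add: \<Lambda> tautological_map_def linear_sum[OF f] linear_scale[OF f]
          distrib_left sum.distrib sum_distrib_right)
    then show "\<Lambda> x = (\<Sum>a\<in>A. \<beta> a x * \<Lambda> a)"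
      using taut x assms by (simp add: \<Lambda>)
  qed
qed

lemma tautological_map_reparametrization:
  "tautological_map A (reparametrization \<beta> \<psi>) x = tautological_map A \<beta> (\<psi> x)"
  by (simp add: tautological_map_def reparametrization_def)

lemma self_homeomorphism_imp_mem:
  "self_homeomorphism S f \<Longrightarrow> x \<in> S \<Longrightarrow> f x \<in> S"
  unfolding self_homeomorphism_def homeomorphism_def by blast

text \<open>Since \<open>\<psi>\<close> maps the hull into itself, the reparametrized weights still
  sum to 1 there, so the criterion for linear precision applies to them. It then says that
  \<open>\<psi>\<close> is a right inverse of the tautological map on the hull.\<close>

lemma linear_precision_reparametrization_iff:
  assumes "finite A" "patch A \<beta>" "self_homeomorphism (convex hull A) \<psi>"
  shows "linear_precision A (reparametrization (normalization A \<beta>) \<psi>) \<longleftrightarrow>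
    (\<forall>x\<in>convex hull A. tautological_map A (normalization A \<beta>) (\<psi> x) = x)"
proof -
  have "(\<Sum>a\<in>A. reparametrization (normalization A \<beta>) \<psi> a x) = 1" if "x \<in> convex hull A" for x
    using sum_normalization[OF assms(1,2) self_homeomorphism_imp_mem[OF assms(3) that]]
    by (simp add: reparametrization_def)
  then show ?thesis
    by (simp add: linear_precision_iff_tautological_map tautological_map_reparametrization)
qed

theorem theorem1p11:
  fixes A :: "(real^'d) set"
    and \<beta> :: "real^'d \<Rightarrow> real^'d \<Rightarrow> real"
  assumes "finite A"
    and "aff_dim (convex hull A) = int CARD('d)"
    and "smooth_patch A \<beta>"
    and "proper A (normalization A \<beta>)"
  shows "\<exists>!\<psi>. \<psi> \<in> extensional (convex hull A) \<and>
               self_homeomorphism (convex hull A) \<psi> \<and>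
               linear_precision A (reparametrization (normalization A \<beta>) \<psi>)"
proof -
  define S where "S = convex hull A"
  define \<tau> where "\<tau> = tautological_map A (normalization A \<beta>)"
  have "patch A \<beta>"
    using assms(3) by (simp add: smooth_patch_def)
  note lp_iff = linear_precision_reparametrization_iff[OF assms(1) this, folded S_def \<tau>_def]
  obtain g where g: "homeomorphism S S \<tau> g"
    using assms(4) unfolding proper_def self_homeomorphism_def S_def \<tau>_def by blast
  \<comment> \<open>The witness is the inverse of \<open>\<tau>\<close>, cut down by
    \<open>restrict\<close> because HOL functions are total: fixing the values outside
    \<open>S\<close> makes uniqueness an equality of functions. On \<open>S\<close> nothing changes,
    so it remains a homeomorphism.\<close>
  have homeo: "self_homeomorphism S (restrict g S)"
    unfolding self_homeomorphism_def
  proof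
    show "homeomorphism S S (restrict g S) \<tau>"
      by (rule homeomorphism_cong[OF homeomorphism_symD[OF g]]) simp_all
  qed
  show ?thesis
    unfolding S_def[symmetric]
  proof (rule ex1I[of _ "restrict g S"])
    show "restrict g S \<in> extensional S \<and> self_homeomorphism S (restrict g S) \<and>
        linear_precision A (reparametrization (normalization A \<beta>) (restrict g S))"
      using homeo lp_iff[OF homeo] homeomorphism_apply2[OF g] by simp
  next
    fix \<psi>
    assume \<psi>: "\<psi> \<in> extensional S \<and> self_homeomorphism S \<psi> \<and>
        linear_precision A (reparametrization (normalization A \<beta>) \<psi>)"
    show "\<psi> = restrict g S"
    proof (rule extensionalityI)
      fix x assume x: "x \<in> S"
      \<comment> \<open>Applying \<open>g\<close> to \<open>\<tau> (\<psi> x) = x\<close> isolates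
        \<open>\<psi> x\<close>. Membership in \<open>S\<close> is required first, as
        \<open>g\<close> is known to undo \<open>\<tau>\<close> only on \<open>S\<close>.\<close>
      have "\<psi> x \<in> S"
        using \<psi> x self_homeomorphism_imp_mem by blast
      moreover have "\<tau> (\<psi> x) = x"
        using \<psi> x lp_iff[of \<psi>] by simp
      ultimately have "\<psi> x = g x"
        using homeomorphism_apply1[OF g, of "\<psi> x"] by simp
      then show "\<psi> x = restrict g S x"
        using x by simp
    qed (use \<psi> in auto)
  qed
qed

end
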